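(* Let $q, a, x$ be real numbers with $0<q<1$, $a \geq 1$ and $x \in [0,1]$. Then $$\frac{1}{\Gamma_q(1+a)} \leq \frac{\Gamma_q(1+x)^a}{\Gamma_q(1+ax)} \leq 1.$$
   Context: For $0<q<1$, the (Jackson) $q$-gamma function is defined by $$\Gamma_q(x)= \frac{(q;q)_\infty}{(q^x;q)_\infty}(1-q)^{1-x},$$ where $(b;q)_\infty = \prod_{n=0}^{\infty}(1-bq^n)$. Here it is evaluated only at real arguments $x>0$. The expression $\Gamma_q(1+x)^a$ means $(\Gamma_q(1+x))^a$, the real power of the positive number $\Gamma_q(1+x)$. *)

theory Defs
  imports "HOL-Analysis.Analysis"
begin

definition qpoch_inf :: "real \<Rightarrow> real \<Rightarrow> real" where
  "qpoch_inf b q = (\<Prod>n. 1 - b * q ^ n)"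

lemma qpoch_inf_has_prod:
  assumes "0 < q" "q < 1"
  shows "(\<lambda>n. 1 - b * q ^ n) has_prod qpoch_inf b q"
proof -
  have "summable (\<lambda>n. norm (- b * q ^ n))"
  proof -
    have "norm q < 1" using assms by simp
    then have "summable (\<lambda>n. q ^ n)" by (rule summable_geometric)
    then have "summable (\<lambda>n. \<bar>b\<bar> * q ^ n)" by (rule summable_mult)
    moreover have "norm (- b * q ^ n) = \<bar>b\<bar> * q ^ n" for n
      using assms by (simp add: abs_mult power_abs)
    ultimately show ?thesis by (simp only:)
  qed
  then have "abs_convergent_prod (\<lambda>n. 1 - b * q ^ n)"
    by (simp add: abs_convergent_prod_conv_summable)
  then have "convergent_prod (\<lambda>n. 1 - b * q ^ n)"
    by (rule abs_convergent_prod_imp_convergent_prod)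
  then show ?thesis
    unfolding qpoch_inf_def by (rule convergent_prod_has_prod)
qed

text \<open>Jackson's \<open>q\<close>-gamma function, intended for \<open>0 < q < 1\<close> and \<open>x > 0\<close>;
  the first argument is the base \<open>q\<close>.\<close>

definition q_Gamma :: "real \<Rightarrow> real \<Rightarrow> real" where
  "q_Gamma q x = qpoch_inf q q / qpoch_inf (q powr x) q * (1 - q) powr (1 - x)"

lemma qpoch_inf_pos:
  assumes "0 < q" "q < 1" "0 \<le> b" "b < 1"
  shows "qpoch_inf b q > 0"
proof -
  have pos: "1 - b * q ^ n > 0" for n
  proof -
    have "b * q ^ n \<le> b * 1"
      using assms by (intro mult_left_mono power_le_one) auto
    then show ?thesis using assms by linarith
  qed
  have hp: "(\<lambda>n. 1 - b * q ^ n) has_prod qpoch_inf b q"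
    using assms by (intro qpoch_inf_has_prod)
  then have "convergent_prod (\<lambda>n. 1 - b * q ^ n)"
    by (simp only: has_prod_iff)
  then have lim: "(\<lambda>n. \<Prod>i\<le>n. 1 - b * q ^ i) \<longlonglongrightarrow> qpoch_inf b q"
    unfolding qpoch_inf_def by (rule convergent_prod_LIMSEQ)
  have "0 \<le> (\<Prod>i\<le>n. 1 - b * q ^ i)" for n
    by (rule prod_nonneg) (rule less_imp_le[OF pos])
  then have "qpoch_inf b q \<ge> 0"
    using LIMSEQ_le_const[OF lim, of 0] by simp
  moreover have "qpoch_inf b q \<noteq> 0"
  proof
    assume "qpoch_inf b q = 0"
    then obtain n where "1 - b * q ^ n = 0"
      using has_prod_eq_0_iff[OF hp] by auto
    then show False using pos[of n] by linarith
  qed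
  ultimately show ?thesis by linarith
qed

lemma q_Gamma_pos:
  assumes "0 < q" "q < 1" "x > 0"
  shows "q_Gamma q x > 0"
proof -
  have "q powr x < 1"
    using powr_less_mono2[of x q 1] assms by simp
  then show ?thesis
    unfolding q_Gamma_def using assms
    by (intro mult_pos_pos divide_pos_pos qpoch_inf_pos) auto
qed

end

theory Submission
  imports Defs
begin

text \<open>Each factor \<open>1 / (1 - q powr (x + n))\<close> of the product for \<open>\<Gamma>\<^sub>q\<close> is log-convex in \<open>x\<close>,
  so \<open>f x = ln (\<Gamma>\<^sub>q (1 + x))\<close> is a convex function, and \<open>f 0 = f 1 = 0\<close>.
  The upper bound is \<open>a * f x \<le> f (a * x)\<close>, convexity between \<open>0\<close> and \<open>a * x\<close>.
  The lower bound is \<open>a * (f 1 - f x) \<le> f a - f (a * x)\<close>, which compares the slope of \<open>f\<close> on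
  \<open>[x, 1]\<close> with its slope on \<open>[a * x, a]\<close>.\<close>

text \<open>The convexity inequality involves only three points at a time, so it passes to pointwise
  limits. This carries convexity from finite partial sums to the infinite product.\<close>

lemma convex_on_LIMSEQ:
  fixes f :: "nat \<Rightarrow> 'a::real_vector \<Rightarrow> real"
  assumes conv: "\<And>n. convex_on A (f n)"
    and lim: "\<And>x. x \<in> A \<Longrightarrow> (\<lambda>n. f n x) \<longlonglongrightarrow> g x"
  shows "convex_on A g"
proof (rule convex_onI)
  show "convex A"
    using conv by (rule convex_on_imp_convex)
  fix t :: real and x y :: 'a
  assume t: "0 < t" "t < 1" and xy: "x \<in> A" "y \<in> A"
  have "(1 - t) *\<^sub>R x + t *\<^sub>R y \<in> A"
    using \<open>convex A\<close> t xy by (simp add: convex_alt)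
  then have "(\<lambda>n. f n ((1 - t) *\<^sub>R x + t *\<^sub>R y)) \<longlonglongrightarrow> g ((1 - t) *\<^sub>R x + t *\<^sub>R y)"
    by (rule lim)
  moreover have "(\<lambda>n. (1 - t) * f n x + t * f n y) \<longlonglongrightarrow> (1 - t) * g x + t * g y"
    using xy by (intro tendsto_intros lim)
  ultimately show "g ((1 - t) *\<^sub>R x + t *\<^sub>R y) \<le> (1 - t) * g x + t * g y"
    by (rule LIMSEQ_le) (use t xy in \<open>auto intro!: convex_onD[OF conv]\<close>)
qed

lemma convex_on_sum_functions:
  fixes f :: "'i \<Rightarrow> 'a::real_vector \<Rightarrow> real"
  assumes "finite I" "convex A" "\<And>i. i \<in> I \<Longrightarrow> convex_on A (f i)"
  shows "convex_on A (\<lambda>x. \<Sum>i\<in>I. f i x)"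
  using assms by (induction I rule: finite_induct) (auto simp: convex_on_const)

lemma convex_on_scaled_ge:
  fixes f :: "real \<Rightarrow> real"
  assumes conv: "convex_on {0..} f" and "f 0 = 0" "1 \<le> a" "0 \<le> x"
  shows "a * f x \<le> f (a * x)"
proof -
  \<comment> \<open>The weight \<open>1 / a\<close>, at most 1, puts the combination of
    \<open>0\<close> and \<open>a * x\<close> at \<open>x\<close>.\<close>
  have "f ((1 - 1 / a) *\<^sub>R 0 + (1 / a) *\<^sub>R (a * x)) \<le> (1 - 1 / a) * f 0 + 1 / a * f (a * x)"
    using assms by (intro convex_onD[OF conv]) auto
  then show ?thesis
    using assms by (simp add: field_simps)
qed

text \<open>Both \<open>1\<close> and \<open>a * x\<close> lie in \<open>[x, a]\<close>, in either
  order, so at both points \<open>f\<close> is below its chord over that interval. Adding the two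
  chord bounds with weights \<open>a\<close> and \<open>1\<close> gives the claim.\<close>

lemma convex_on_slope_scaled:
  fixes f :: "real \<Rightarrow> real"
  assumes conv: "convex_on {0..} f" and "1 \<le> a" "0 \<le> x" "x \<le> 1"
  shows "a * (f 1 - f x) \<le> f a - f (a * x)"
proof (cases "a = x")
  case True
  then have "a = 1" "x = 1"
    using assms by auto
  then show ?thesis
    by simp
next
  case False
  define d where "d = a - x"
  have d: "d > 0"
    using False assms by (simp add: d_def)
  have cv: "convex_on {x..a} f"
    using assms by (intro convex_on_subset[OF conv]) auto
  have ax: "x \<le> a * x" "a * x \<le> a"
    using assms mult_right_mono[of 1 a x] mult_left_mono[of x 1 a] by auto
  have "d * f 1 \<le> (f a - f x) * (1 - x) + d * f x"
    using convex_onD_Icc'[OF cv, of 1] d assms by (simp add: d_def[symmetric] field_simps)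
  then have 1: "a * (d * f 1) \<le> a * ((f a - f x) * (1 - x) + d * f x)"
    using assms by (intro mult_left_mono) auto
  have 2: "d * f (a * x) \<le> (f a - f x) * (a * x - x) + d * f x"
    using convex_onD_Icc'[OF cv, of "a * x"] d ax by (simp add: d_def[symmetric] field_simps)
  have "d * (a * f 1 + f (a * x))
      \<le> a * ((f a - f x) * (1 - x) + d * f x) + ((f a - f x) * (a * x - x) + d * f x)"
    using 1 2 by (simp add: algebra_simps)
  \<comment> \<open>The chord is affine and \<open>a * 1 + a * x = a * x + 1 * a\<close>, so its
    weighted values at \<open>1\<close> and \<open>a * x\<close> add up to those at the endpoints
    \<open>x\<close> and \<open>a\<close>, where it agrees with \<open>f\<close>.\<close>
  also have "\<dots> = d * (a * f x + f a)"
    by (simp add: d_def algebra_simps)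
  finally have "a * f 1 + f (a * x) \<le> a * f x + f a"
    using d by (simp only: mult_le_cancel_left_pos)
  then show ?thesis
    by (simp add: algebra_simps)
qed

lemma powr_less_1:
  fixes q x :: real
  assumes "0 < q" "q < 1" "0 < x"
  shows "q powr x < 1"
  using powr_less_mono2[of x q 1] assms by simp

lemma one_minus_powr_mult_power_pos:
  fixes q x :: real
  assumes "0 < q" "q < 1" "0 < x"
  shows "0 < 1 - q powr x * q ^ n"
proof -
  have "q powr x * q ^ n \<le> q powr x * 1"
    using assms by (intro mult_left_mono power_le_one) auto
  then show ?thesis
    using powr_less_1[OF assms] by linarith
qed

lemma convex_on_neg_ln_one_minus_powr:
  fixes q :: real
  assumes q: "0 < q" "q < 1"
  shows "convex_on {0<..} (\<lambda>x. - ln (1 - q powr x * q ^ n))"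
proof (rule convex_on_realI)
  fix x :: real
  assume "x \<in> {0<..}"
  \<comment> \<open>With \<open>u = q powr x * q ^ n\<close> the derivative is
    \<open>ln q * u / (1 - u)\<close>. Here \<open>u\<close> decreases in \<open>x\<close> and
    \<open>ln q\<close> is negative, so the derivative increases.\<close>
  then show "((\<lambda>x. - ln (1 - q powr x * q ^ n)) has_real_derivative
      ln q * (1 / (1 - q powr x * q ^ n) - 1)) (at x)"
    using one_minus_powr_mult_power_pos[OF q, of x n] q
    by (auto intro!: derivative_eq_intros simp: field_simps)
next
  fix x y :: real
  assume xy: "x \<in> {0<..}" "y \<in> {0<..}" "x \<le> y"
  have "q powr y * q ^ n \<le> q powr x * q ^ n"
    using q xy by (intro mult_right_mono powr_mono') auto
  then have "1 / (1 - q powr y * q ^ n) \<le> 1 / (1 - q powr x * q ^ n)"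
    using one_minus_powr_mult_power_pos[OF q, of y n] one_minus_powr_mult_power_pos[OF q, of x n] xy
    by (intro divide_left_mono mult_pos_pos) auto
  then show "ln q * (1 / (1 - q powr x * q ^ n) - 1) \<le> ln q * (1 / (1 - q powr y * q ^ n) - 1)"
    using q by (intro mult_left_mono_neg) auto
qed simp

lemma ln_qpoch_inf_sums:
  assumes "0 < q" "q < 1" "0 < x"
  shows "(\<lambda>n. ln (1 - q powr x * q ^ n)) sums ln (qpoch_inf (q powr x) q)"
  using assms
  by (intro has_prod_imp_sums_ln_real' qpoch_inf_has_prod one_minus_powr_mult_power_pos)

lemma convex_on_neg_ln_qpoch_inf:
  assumes q: "0 < q" "q < 1"
  shows "convex_on {0<..} (\<lambda>x. - ln (qpoch_inf (q powr x) q))"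
proof (rule convex_on_LIMSEQ)
  show "convex_on {0<..} (\<lambda>x. \<Sum>k<n. - ln (1 - q powr x * q ^ k))" for n
    using q by (intro convex_on_sum_functions convex_on_neg_ln_one_minus_powr) auto
  show "(\<lambda>n. \<Sum>k<n. - ln (1 - q powr x * q ^ k)) \<longlonglongrightarrow> - ln (qpoch_inf (q powr x) q)"
    if "x \<in> {0<..}" for x
    using sums_minus[OF ln_qpoch_inf_sums[OF q, of x]] that by (simp add: sums_def)
qed

lemma ln_q_Gamma:
  assumes q: "0 < q" "q < 1" and x: "0 < x"
  shows "ln (q_Gamma q x) =
    - ln (qpoch_inf (q powr x) q) + (ln (qpoch_inf q q) + (1 - x) * ln (1 - q))"
proof -
  have "qpoch_inf q q > 0" "qpoch_inf (q powr x) q > 0"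
    using q powr_less_1[OF q x] by (auto intro!: qpoch_inf_pos)
  then show ?thesis
    using q by (simp add: q_Gamma_def ln_mult ln_div ln_powr)
qed

text \<open>By \<open>ln_q_Gamma\<close>, the logarithm is the convex term from the infinite product
  plus an affine function of \<open>x\<close>.\<close>

lemma convex_on_ln_q_Gamma:
  assumes q: "0 < q" "q < 1"
  shows "convex_on {0<..} (\<lambda>x. ln (q_Gamma q x))"
proof -
  have "convex_on {0<..} (\<lambda>x. ln (qpoch_inf q q) + (1 - x) * ln (1 - q))"
    by (rule convex_on_realI[where f' = "\<lambda>_. - ln (1 - q)"]) (auto intro!: derivative_eq_intros)
  then have conv: "convex_on {0<..} (\<lambda>x. - ln (qpoch_inf (q powr x) q)
      + (ln (qpoch_inf q q) + (1 - x) * ln (1 - q)))"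
    by (rule convex_on_add[OF convex_on_neg_ln_qpoch_inf[OF q]])
  \<comment> \<open>The formula \<open>ln_q_Gamma\<close> is available only at positive arguments,
    so it is applied at the three points of the convexity inequality.\<close>
  show ?thesis
  proof (rule convex_onI)
    fix t x y :: real
    assume *: "0 < t" "t < 1" "x \<in> {0<..}" "y \<in> {0<..}"
    then have "0 < (1 - t) *\<^sub>R x + t *\<^sub>R y"
      by (simp add: add_pos_pos)
    then show "ln (q_Gamma q ((1 - t) *\<^sub>R x + t *\<^sub>R y))
        \<le> (1 - t) * ln (q_Gamma q x) + t * ln (q_Gamma q y)"
      using * q convex_onD[OF conv, of t x y] by (simp only: ln_q_Gamma greaterThan_iff less_imp_le)
  qed simp
qed

lemma q_Gamma_1:
  assumes "0 < q" "q < 1"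
  shows "q_Gamma q 1 = 1"
  using assms qpoch_inf_pos[of q q] by (simp add: q_Gamma_def)

text \<open>Splits off the factor \<open>n = 0\<close>; the remaining factors form the product with
  base point \<open>b * q\<close>.\<close>

lemma qpoch_inf_rec:
  assumes q: "0 < q" "q < 1" and "b \<noteq> 1"
  shows "qpoch_inf b q = (1 - b) * qpoch_inf (b * q) q"
proof -
  have "(\<lambda>n. 1 - b * q ^ Suc n) has_prod qpoch_inf (b * q) q"
    using qpoch_inf_has_prod[OF q, of "b * q"] by (simp add: mult.assoc)
  then have "(\<lambda>n. 1 - b * q ^ n) has_prod (qpoch_inf (b * q) q * (1 - b * q ^ 0))"
    by (rule has_prod_Suc_imp)
  then show ?thesis
    using has_prod_unique2[OF qpoch_inf_has_prod[OF q, of b]] by (simp add: mult.commute)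
qed

text \<open>The factor \<open>1 - q\<close> split off from \<open>qpoch_inf q q\<close> cancels
  \<open>(1 - q) powr (-1)\<close>. This provides the zero of \<open>f\<close> at 1.\<close>

lemma q_Gamma_2:
  assumes q: "0 < q" "q < 1"
  shows "q_Gamma q 2 = 1"
proof -
  have "q * q < 1 * 1"
    using q by (intro mult_strict_mono) auto
  then have "qpoch_inf (q * q) q > 0"
    using q by (intro qpoch_inf_pos) auto
  moreover have "q powr 2 = q * q"
    using q by (simp add: power2_eq_square)
  ultimately show ?thesis
    using q qpoch_inf_rec[OF q, of q]
    by (simp add: q_Gamma_def powr_minus field_simps)
qed

theorem theorem2p1:
  fixes q a x :: real
  assumes "0 < q" and "q < 1" and "a \<ge> 1" and "x \<in> {0..1}"
  shows "1 / q_Gamma q (1 + a) \<le> q_Gamma q (1 + x) powr a / q_Gamma q (1 + a * x) \<and>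
         q_Gamma q (1 + x) powr a / q_Gamma q (1 + a * x) \<le> 1"
proof -
  define f where "f = (\<lambda>x. ln (q_Gamma q (1 + x)))"
  have Gamma_eq: "q_Gamma q (1 + y) = exp (f y)" if "0 \<le> y" for y
    using assms that by (simp add: f_def q_Gamma_pos)
  have f01: "f 0 = 0" "f 1 = 0"
    using assms by (simp_all add: f_def q_Gamma_1 q_Gamma_2)
  have conv: "convex_on {0..} f"
  proof (rule convex_onI)
    fix t x y :: real
    assume *: "0 < t" "t < 1" "x \<in> {0..}" "y \<in> {0..}"
    \<comment> \<open>The shift by 1 respects convex combinations and moves \<open>{0..}\<close>
      into \<open>{0<..}\<close>.\<close>
    have "1 + ((1 - t) *\<^sub>R x + t *\<^sub>R y) = (1 - t) *\<^sub>R (1 + x) + t *\<^sub>R (1 + y)"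
      by (simp add: algebra_simps)
    then show "f ((1 - t) *\<^sub>R x + t *\<^sub>R y) \<le> (1 - t) * f x + t * f y"
      using * convex_onD[OF convex_on_ln_q_Gamma[OF assms(1,2)], of t "1 + x" "1 + y"]
      by (simp add: f_def)
  qed simp
  have x: "0 \<le> x" "x \<le> 1" "0 \<le> a * x"
    using assms by auto
  \<comment> \<open>In exponential form both bounds become
    \<open>- f a \<le> a * f x - f (a * x) \<le> 0\<close>.\<close>
  have ratio: "q_Gamma q (1 + x) powr a / q_Gamma q (1 + a * x) = exp (a * f x - f (a * x))"
    using x by (simp add: Gamma_eq exp_powr_real exp_diff mult.commute)
  have "1 / q_Gamma q (1 + a) = exp (- f a)"
    using assms by (simp add: Gamma_eq exp_minus inverse_eq_divide)
  moreover have "- f a \<le> a * f x - f (a * x)"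
    using convex_on_slope_scaled[OF conv, of a x] assms x f01 by simp
  moreover have "a * f x \<le> f (a * x)"
    using convex_on_scaled_ge[OF conv, of a x] assms x f01 by simp
  ultimately show ?thesis
    by (simp add: ratio)
qed

end
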